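(* Let $A^{(1)},\dots,A^{(K)}\in\mathbb{R}^{n\times n}$ be symmetric matrices, let $\boldsymbol{p}_k=[\underline{p}_k,\overline{p}_k]$, $k=1,\dots,K$, be compact real intervals, and let $\boldsymbol{p}=\boldsymbol{p}_1\times\dots\times\boldsymbol{p}_K$. For $p\in\mathbb{R}^K$ let $A(p)=\sum_{k=1}^K A^{(k)}p_k$. For each $k=1,\dots,K$, let $A^{(k)}=A^{(k)}_1-A^{(k)}_2$, where both $A^{(k)}_1,A^{(k)}_2\in\mathbb{R}^{n\times n}$ are positive semidefinite. If the matrix $$\sum_{k=1}^K\left(A^{(k)}_1\underline{p}_k-A^{(k)}_2\overline{p}_k\right)$$ is positive definite, then the parametric matrix $A(p)$, $p\in\boldsymbol{p}$, is strongly positive definite.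
   Context: The parametric matrix $A(p)$, $p\in\boldsymbol{p}$, is called strongly positive definite if $A(p)$ is positive definite for each $p\in\boldsymbol{p}$. Intervals satisfy $\underline{p}_k\le\overline{p}_k$. Positive (semi)definite refers to real symmetric matrices. *)

theory Defs
  imports "HOL-Analysis.Analysis"
begin

definition symmetric_matrix :: "real ^ 'n ^ 'n \<Rightarrow> bool" where
  "symmetric_matrix M \<longleftrightarrow> transpose M = M"

definition pos_semidef :: "real ^ 'n ^ 'n \<Rightarrow> bool" where
  "pos_semidef M \<longleftrightarrow> symmetric_matrix M \<and> (\<forall>x. x \<bullet> (M *v x) \<ge> 0)"

definition pos_def :: "real ^ 'n ^ 'n \<Rightarrow> bool" where
  "pos_def M \<longleftrightarrow> symmetric_matrix M \<and> (\<forall>x. x \<noteq> 0 \<longrightarrow> x \<bullet> (M *v x) > 0)"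

definition param_matrix :: "('k::finite \<Rightarrow> real ^ 'n ^ 'n) \<Rightarrow> real ^ 'k \<Rightarrow> real ^ 'n ^ 'n" where
  "param_matrix A p = (\<Sum>k\<in>UNIV. (p $ k) *\<^sub>R A k)"

definition strongly_pos_def :: "(real ^ 'k \<Rightarrow> real ^ 'n ^ 'n) \<Rightarrow> (real ^ 'k) set \<Rightarrow> bool" where
  "strongly_pos_def M P \<longleftrightarrow> (\<forall>p\<in>P. pos_def (M p))"

end

theory Submission
  imports Defs
begin

text \<open>
  The matrix assumed positive definite, call it \<open>L\<close>, is a lower bound of all \<open>A(p)\<close> with
  \<open>p\<close> in the box, in the Loewner order: since \<open>A k = A1 k - A2 k\<close>,
  \[ A(p) - L = \sum_k (p_k - \underline{p}_k) A1_k + (\overline{p}_k - p_k) A2_k, \]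
  and on the box both coefficients are nonnegative, so the difference is a conic combination of
  positive semidefinite matrices.  What carries the proof is therefore that the positive
  semidefinite matrices form a convex cone (\<open>pos_semidef_scaleR\<close>, \<open>pos_semidef_add\<close>,
  \<open>pos_semidef_sum\<close>), and that adding an element of this cone preserves positive definiteness
  (\<open>pos_def_add_pos_semidef\<close>).
\<close>

lemma symmetric_matrix_add:
  "symmetric_matrix M \<Longrightarrow> symmetric_matrix N \<Longrightarrow> symmetric_matrix (M + N)"
  by (simp add: symmetric_matrix_def transpose_def vec_eq_iff)

lemma symmetric_matrix_scaleR:
  "symmetric_matrix M \<Longrightarrow> symmetric_matrix (c *\<^sub>R M)"
  by (simp add: symmetric_matrix_def transpose_def vec_eq_iff)

lemma pos_semidef_zero: "pos_semidef 0"
  by (simp add: pos_semidef_def symmetric_matrix_def transpose_def vec_eq_iff)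

lemma pos_semidef_add:
  "pos_semidef M \<Longrightarrow> pos_semidef N \<Longrightarrow> pos_semidef (M + N)"
  by (simp add: pos_semidef_def symmetric_matrix_add matrix_vector_mult_add_rdistrib inner_add_right)

lemma pos_semidef_scaleR:
  "0 \<le> c \<Longrightarrow> pos_semidef M \<Longrightarrow> pos_semidef (c *\<^sub>R M)"
  by (simp add: pos_semidef_def symmetric_matrix_scaleR flip: scaleR_matrix_vector_assoc)

lemma pos_semidef_sum:
  "(\<And>i. i \<in> I \<Longrightarrow> pos_semidef (M i)) \<Longrightarrow> pos_semidef (\<Sum>i\<in>I. M i)"
  by (induction I rule: infinite_finite_induct) (simp_all add: pos_semidef_zero pos_semidef_add)

lemma pos_def_add_pos_semidef:
  "pos_def M \<Longrightarrow> pos_semidef N \<Longrightarrow> pos_def (M + N)"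
  by (simp add: pos_def_def pos_semidef_def symmetric_matrix_add
      matrix_vector_mult_add_rdistrib inner_add_right add_pos_nonneg)

theorem theorem9:
  fixes A A1 A2 :: "'k::finite \<Rightarrow> real ^ 'n ^ 'n"
    and pl pu :: "real ^ 'k"
  assumes "\<And>k. symmetric_matrix (A k)"
    and "\<And>k. pl $ k \<le> pu $ k"
    and "\<And>k. A k = A1 k - A2 k"
    and "\<And>k. pos_semidef (A1 k)"
    and "\<And>k. pos_semidef (A2 k)"
    and "pos_def (\<Sum>k\<in>UNIV. (pl $ k) *\<^sub>R A1 k - (pu $ k) *\<^sub>R A2 k)"
  shows "strongly_pos_def (param_matrix A) (cbox pl pu)"
  unfolding strongly_pos_def_def
proof
  fix p assume "p \<in> cbox pl pu"
  then have box: "pl $ k \<le> p $ k" "p $ k \<le> pu $ k" for k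
    by (simp_all add: mem_box_cart)
  let ?L = "\<Sum>k\<in>UNIV. (pl $ k) *\<^sub>R A1 k - (pu $ k) *\<^sub>R A2 k"
  let ?D = "\<Sum>k\<in>UNIV. (p $ k - pl $ k) *\<^sub>R A1 k + (pu $ k - p $ k) *\<^sub>R A2 k"
  have "param_matrix A p = ?L + ?D"
    unfolding param_matrix_def sum.distrib[symmetric]
    by (rule sum.cong) (simp_all add: assms(3) algebra_simps)
  moreover have "pos_semidef ?D"
    using box assms(4,5) by (intro pos_semidef_sum pos_semidef_add pos_semidef_scaleR) simp_all
  ultimately show "pos_def (param_matrix A p)"
    using assms(6) pos_def_add_pos_semidef by simp
qed

end
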